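(* For all integers $n \ge 0$ and $r \ge 0$, the value of the Bernoulli polynomial $B_n(x)$ at $x = r$ satisfies \[ B_n(r) = \sum_{k=0}^{n} (-1)^k \frac{k!}{k+1}\, S_r(n+r, k+r), \] where $S_r(m,j)$ denotes the $r$-Stirling number of the second kind.
   Context: The Bernoulli polynomials $B_n(x)$, $n \ge 0$, are defined by the generating function $\frac{t e^{xt}}{e^t - 1} = \sum_{n=0}^\infty B_n(x) \frac{t^n}{n!}$ for $|t| < 2\pi$. For an integer $r \ge 1$, the $r$-Stirling number of the second kind $S_r(m,j)$ is the number of partitions of the set $\{1,2,\dots,m\}$ into $j$ non-empty disjoint subsets such that the elements $1,2,\dots,r$ lie in distinct subsets. For $r=0$, $S_0(m,j)=S(m,j)$ is the ordinary Stirling number of the second kind (number of partitions of $\{1,\dots,m\}$ into $j$ non-empty blocks, with $S(0,0)=1$ and $S(m,0)=0$ for $m\ge1$). Also $S_r(m,j)=0$ when $j>m$. *)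

theory Defs
  imports "HOL-Complex_Analysis.Complex_Analysis" "HOL-Library.Disjoint_Sets"
begin

section \<open>Bernoulli polynomials\<close>

text \<open>
  The point \<open>t = 0\<close> is excluded because the left-hand side has a removable singularity there, and
  HOL's convention \<open>0 / 0 = 0\<close> would contradict its limit \<open>1\<close>.
\<close>

definition bernoulli_gf :: "(nat \<Rightarrow> real poly) \<Rightarrow> bool" where
  "bernoulli_gf B \<longleftrightarrow>
     (\<forall>(x :: real) (t :: complex). t \<noteq> 0 \<longrightarrow> norm t < 2 * pi \<longrightarrow>
        (\<lambda>n. of_real (poly (B n) x) * (t ^ n / fact n)) sums (t * exp (of_real x * t) / (exp t - 1)))"

definition bernoulli_poly :: "nat \<Rightarrow> real poly" where
  "bernoulli_poly = (THE B. bernoulli_gf B)"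

text \<open>
  The description above is proper: exactly one sequence of polynomials has this generating function.
\<close>

lemma bernoulli_gf_unique:
  assumes "bernoulli_gf B" "bernoulli_gf C"
  shows "B = C"
proof -
  have "poly (B n) x = poly (C n) x" for n x
  proof -
    define a where "a = (\<lambda>n. complex_of_real (poly (B n) x - poly (C n) x) / fact n)"
    have a: "(\<lambda>n. a n * t ^ n) sums 0" if "t \<noteq> 0" "norm t < 2 * pi" for t
    proof -
      have "(\<lambda>n. of_real (poly (B n) x) * (t ^ n / fact n)
              - of_real (poly (C n) x) * (t ^ n / fact n)) sums
            (t * exp (of_real x * t) / (exp t - 1) - t * exp (of_real x * t) / (exp t - 1))"
        using assms that unfolding bernoulli_gf_def by (intro sums_diff) blast+
      also have "(\<lambda>n. of_real (poly (B n) x) * (t ^ n / fact n)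
              - of_real (poly (C n) x) * (t ^ n / fact n)) = (\<lambda>n. a n * t ^ n)"
        by (auto simp: a_def field_simps)
      finally show ?thesis by simp
    qed
    have "((\<lambda>_. 0) \<longlongrightarrow> a 0) (at (0 :: complex))"
      by (rule powser_limit_0_strong[of "2 * pi" a "\<lambda>_. 0"]) (use a in auto)
    hence a0: "a 0 = 0"
      by (metis LIM_const_eq)
    have a': "(\<lambda>n. a n * t ^ n) sums 0" if "norm t < 2 * pi" for t
      using a[of t] that a0 powser_sums_zero[of a] by (cases "t = 0") auto
    have an: "a n = 0"
    proof (rule ccontr)
      assume "a n \<noteq> 0"
      with a0 have "n > 0" by (metis gr0I)
      obtain s where s: "s > 0" "\<And>z :: complex. z \<in> cball 0 s - {0} \<Longrightarrow> (0 :: complex) \<noteq> 0"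
        using powser_0_nonzero[of "2 * pi" 0 a "\<lambda>_. 0" n] a' \<open>a n \<noteq> 0\<close> \<open>n > 0\<close>
        by (metis diff_zero m2pi_less_pi pi_gt_zero mult_pos_pos zero_less_numeral)
      from s(2)[of "of_real s"] s(1) show False by simp
    qed
    hence "complex_of_real (poly (B n) x - poly (C n) x) = 0"
      by (simp add: a_def)
    thus ?thesis by (metis of_real_eq_0_iff eq_iff_diff_eq_0)
  qed
  thus ?thesis by (auto simp: fun_eq_iff poly_eq_poly_eq_iff [symmetric])
qed

lemma exp_neq_1_in_ball:
  fixes t :: complex
  assumes "t \<noteq> 0" "norm t < 2 * pi"
  shows "exp t \<noteq> 1"
proof
  assume "exp t = 1"
  then obtain n :: int where n: "Re t = 0" "Im t = of_int (2 * n) * pi"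
    by (auto simp: exp_eq_1)
  have "norm t = \<bar>Im t\<bar>" using n by (simp add: cmod_eq_Im)
  also have "\<dots> = 2 * pi * of_int \<bar>n\<bar>" using n by (simp add: abs_mult)
  finally have *: "norm t = 2 * pi * of_int \<bar>n\<bar>" .
  with assms(1) have "\<bar>n\<bar> \<ge> 1" by (cases "n = 0") auto
  hence "2 * pi * of_int \<bar>n\<bar> \<ge> 2 * pi * 1"
    by (intro mult_left_mono) auto
  with * assms show False by simp
qed

lemma bernoulli_gf_exists: "\<exists>B. bernoulli_gf B"
proof -
  define G where "G = Abs_fps (\<lambda>n. 1 / fact (Suc n) :: real)"
  define G' where "G' = Abs_fps (\<lambda>n. 1 / fact (Suc n) :: complex)"
  define H where "H = Abs_fps (\<lambda>n. complex_of_real (fps_nth (inverse G) n))"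
  define B where "B = (\<lambda>n. \<Sum>k\<le>n. monom (fact n * fps_nth (inverse G) k / fact (n - k)) (n - k))"
  have "inverse G * G = 1"
    by (rule inverse_mult_eq_1) (simp add: G_def)
  hence GG: "fps_nth (inverse G * G) n = fps_nth 1 n" for n
    by simp
  have "fps_nth (H * G') n = of_real (fps_nth (inverse G * G) n)" for n
    by (simp add: fps_mult_nth H_def G'_def G_def)
  hence HG: "H * G' = 1"
    unfolding GG by (simp add: fps_eq_iff)
  hence H: "H = inverse G'"
    by (metis fps_inverse_unique mult.commute)
  have G'_shift: "G' = fps_shift 1 (fps_exp 1 - 1)"
    by (simp add: fps_eq_iff G'_def algebra_simps)
  have rad0: "fps_conv_radius (fps_exp 1 - 1 :: complex fps) = \<infinity>"
    using fps_conv_radius_diff[of "fps_exp 1 :: complex fps" 1] by simp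
  have radG: "fps_conv_radius G' = \<infinity>"
    unfolding G'_shift using rad0 by simp
  have evG: "eval_fps G' t = (exp t - 1) / t" if "t \<noteq> 0" for t
  proof -
    have "eval_fps (fps_exp 1 - 1 :: complex fps) t = exp t - 1"
      by (subst eval_fps_diff) auto
    moreover have "(fps_exp 1 - 1 :: complex fps) = G' * fps_X"
    proof (rule fps_ext)
      show "fps_nth (fps_exp 1 - 1 :: complex fps) n = fps_nth (G' * fps_X) n" for n
        by (cases n) (simp_all add: G'_def algebra_simps)
    qed
    moreover have "eval_fps (G' * fps_X) t = eval_fps G' t * t"
      by (subst eval_fps_mult) (auto simp: radG)
    ultimately show ?thesis using that by (simp add: field_simps)
  qed
  have nz: "eval_fps G' t \<noteq> 0" if "t \<in> eball 0 (ereal (2 * pi))" for t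
  proof (cases "t = 0")
    case True
    thus ?thesis by (simp add: eval_fps_at_0 G'_def)
  next
    case False
    thus ?thesis using that exp_neq_1_in_ball[of t] by (simp add: evG)
  qed
  have radH: "fps_conv_radius H \<ge> ereal (2 * pi)"
    using fps_conv_radius_inverse[of "ereal (2 * pi)" G'] nz by (simp add: H radG)
  have evH: "eval_fps H t = t / (exp t - 1)" if "t \<noteq> 0" "norm t < 2 * pi" for t
    unfolding H using that nz
    by (subst eval_fps_inverse[of "ereal (2 * pi)" G']) (auto simp: radG evG)
  have B: "of_real (poly (B n) x) / fact n = fps_nth (H * fps_exp (of_real x)) n" for n x
    by (simp add: B_def poly_sum poly_monom fps_mult_nth H_def sum_divide_distrib atLeast0AtMost)
  have "bernoulli_gf B"
    unfolding bernoulli_gf_def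
  proof (intro allI impI)
    fix x :: real and t :: complex
    assume t: "t \<noteq> 0" "norm t < 2 * pi"
    have tH: "ereal (norm t) < fps_conv_radius H"
      using radH t by (metis ereal_less(2) less_ereal.simps(1) less_le_trans)
    have "ereal (norm t) < fps_conv_radius (H * fps_exp (of_real x))"
      using fps_conv_radius_mult[of H "fps_exp (of_real x)"] tH
      by (simp add: less_le_trans)
    hence "(\<lambda>n. fps_nth (H * fps_exp (of_real x)) n * t ^ n) sums eval_fps (H * fps_exp (of_real x)) t"
      by (rule sums_eval_fps)
    also have "eval_fps (H * fps_exp (of_real x)) t = t / (exp t - 1) * exp (of_real x * t)"
      using t tH by (subst eval_fps_mult) (auto simp: evH)
    finally show "(\<lambda>n. of_real (poly (B n) x) * (t ^ n / fact n)) sums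
                    (t * exp (of_real x * t) / (exp t - 1))"
      by (simp add: B [symmetric] field_simps)
  qed
  thus ?thesis by blast
qed

lemma bernoulli_gf_bernoulli_poly: "bernoulli_gf bernoulli_poly"
  unfolding bernoulli_poly_def
proof (rule theI'[of bernoulli_gf])
  show "\<exists>!B. bernoulli_gf B"
    using bernoulli_gf_exists bernoulli_gf_unique by blast
qed


section \<open>\<open>r\<close>-Stirling numbers of the second kind\<close>

text \<open>
  The last condition says that each of \<open>1, \<dots>, r\<close> lies in a block containing none of the others.
  For \<open>m < r\<close> it is unsatisfiable, so the number is \<open>0\<close>; for \<open>r = 0\<close> it is vacuous.
\<close>

definition r_Stirling :: "nat \<Rightarrow> nat \<Rightarrow> nat \<Rightarrow> nat" where
  "r_Stirling r m j =
     card {P. partition_on {1..m} P \<and> card P = j \<and> (\<forall>i\<in>{1..r}. \<exists>p\<in>P. p \<inter> {1..r} = {i})}"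

end

theory Submission
  imports Defs
begin

text \<open>
  Adding a new element to a partition, either as a singleton or to one of its blocks, gives the
  triangular recurrence of the \<open>r\<close>-Stirling numbers. It is the recurrence satisfied by the
  coefficients of \<open>exp (r t) (exp t - 1) ^ k\<close>, so that
  \<open>\<Sum>n. S\<^sub>r(n + r, k + r) t ^ n / n! = exp (r t) (exp t - 1) ^ k / k!\<close>.
  Weighting this by \<open>(-1) ^ k k! / (k + 1)\<close> and summing over \<open>k\<close> yields \<open>exp (r t) ln (1 + u) / u\<close>
  with \<open>u = exp t - 1\<close>, which is \<open>t exp (r t) / (exp t - 1)\<close>.
\<close>

section \<open>Set partitions separating a given subset\<close>

text \<open>General sets in place of intervals let \<open>A\<close> grow by one element while
  \<open>R\<close> stays fixed.\<close>

definition separating_partitions :: "'a set \<Rightarrow> 'a set \<Rightarrow> nat \<Rightarrow> 'a set set set" where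
  "separating_partitions A R j =
     {P. partition_on A P \<and> card P = j \<and> (\<forall>i\<in>R. \<exists>p\<in>P. p \<inter> R = {i})}"

lemma r_Stirling_eq_card: "r_Stirling r m j = card (separating_partitions {1..m} {1..r} j)"
  by (simp add: r_Stirling_def separating_partitions_def)

lemma finite_separating_partitions:
  assumes "finite A"
  shows "finite (separating_partitions A R j)"
  by (rule finite_subset[OF _ finitely_many_partition_on[OF assms]])
     (auto simp: separating_partitions_def)

text \<open>A block that meets \<open>R\<close> in \<open>{i}\<close> determines \<open>i\<close>,
  so choosing such a block for each \<open>i\<close> in \<open>R\<close> is injective.\<close>

lemma card_separating_le:
  assumes "finite A" "P \<in> separating_partitions A R j"
  shows "card R \<le> j"
proof -
  have P: "partition_on A P" "card P = j" "\<forall>i\<in>R. \<exists>p\<in>P. p \<inter> R = {i}"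
    using assms(2) by (auto simp: separating_partitions_def)
  have fin: "finite P" using assms(1) P(1) by (rule finite_elements)
  from P(3) obtain f where f: "\<And>i. i \<in> R \<Longrightarrow> f i \<in> P \<and> f i \<inter> R = {i}"
    by metis
  have "inj_on f R" by (rule inj_onI) (metis f singleton_inject)
  thus ?thesis using card_inj_on_le[of f R P] f fin P(2) by auto
qed

text \<open>Deleting \<open>x\<close> from its block either removes the block \<open>{x}\<close> or
  leaves a nonempty block \<open>p\<close>. Since \<open>x\<close> lies outside \<open>R\<close>,
  the intersections of blocks with \<open>R\<close> do not change.\<close>

lemma separating_partitions_insert:
  assumes A: "finite A" "x \<notin> A" "R \<subseteq> A"
  shows "separating_partitions (insert x A) R (Suc j) =
           insert {x} ` separating_partitions A R j \<union>
           (\<lambda>(P, p). insert (insert x p) (P - {p})) ` (SIGMA P:separating_partitions A R (Suc j). P)"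
    (is "?L = ?S \<union> ?T")
proof (intro equalityI subsetI)
  fix Q assume "Q \<in> ?L"
  hence Q: "partition_on (insert x A) Q" "card Q = Suc j" "\<And>i. i \<in> R \<Longrightarrow> \<exists>p\<in>Q. p \<inter> R = {i}"
    by (auto simp: separating_partitions_def)
  have UQ: "\<Union>Q = insert x A" and dQ: "disjoint Q" and eQ: "{} \<notin> Q"
    using Q(1) by (auto simp: partition_on_def)
  have finQ: "finite Q" using Q(2) card_ge_0_finite by force
  obtain q where q: "q \<in> Q" "x \<in> q" using UQ by blast
  have others: "p \<inter> q = {}" if "p \<in> Q" "p \<noteq> q" for p
    using dQ that q(1) by (auto simp: disjoint_def)
  have UQ': "\<Union>(Q - {q}) = insert x A - q"
  proof -
    have "z \<notin> q" if "p \<in> Q" "p \<noteq> q" "z \<in> p" for p z using others[OF that(1,2)] that(3) by auto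
    thus ?thesis using UQ by auto
  qed
  show "Q \<in> ?S \<union> ?T"
  proof (cases "q = {x}")
    case True
    have "partition_on A (Q - {{x}})"
    proof (rule partition_onI)
      show "\<Union>(Q - {{x}}) = A" using UQ' A(2) by (simp add: True)
      show "disjnt a b" if "a \<in> Q - {{x}}" "b \<in> Q - {{x}}" "a \<noteq> b" for a b
        using disjointD[OF dQ] that by (simp add: disjnt_def)
      show "{} \<notin> Q - {{x}}" using eQ by simp
    qed
    moreover have "\<exists>p\<in>Q - {{x}}. p \<inter> R = {i}" if "i \<in> R" for i
    proof -
      obtain p where p: "p \<in> Q" "p \<inter> R = {i}" using Q(3)[OF \<open>i \<in> R\<close>] by blast
      have "p \<noteq> {x}" using p(2) A(2,3) \<open>i \<in> R\<close> by auto
      thus ?thesis using p by blast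
    qed
    ultimately have "Q - {{x}} \<in> separating_partitions A R j"
      using Q(2) q(1) True finQ by (auto simp: separating_partitions_def)
    moreover have "Q = insert {x} (Q - {{x}})" using q(1) True by auto
    ultimately show ?thesis by blast
  next
    case False
    define p where "p = q - {x}"
    have p: "p \<noteq> {}" "x \<notin> p" "insert x p = q" using False q by (auto simp: p_def)
    \<comment> \<open>A nonempty proper subset of \<open>q\<close> cannot be another block, so
      replacing \<open>q\<close> by \<open>p\<close> preserves the number of blocks.\<close>
    have pQ: "p \<notin> Q" using others[of p] p by auto
    let ?P = "insert p (Q - {q})"
    have "partition_on A ?P"
    proof (rule partition_onI)
      show "\<Union>?P = A" using UQ UQ' q A(2) by (auto simp: p_def)
      fix a b assume "a \<in> ?P" "b \<in> ?P" "a \<noteq> b"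
      thus "disjnt a b"
        using disjointD[OF dQ, of a b] others[of a] others[of b] by (auto simp: disjnt_def p_def)
    next
      show "{} \<notin> ?P" using p(1) eQ by auto
    qed
    moreover have "card ?P = Suc j"
      using card_Suc_Diff1[OF finQ q(1)] finQ pQ Q(2) by simp
    moreover have "\<exists>a\<in>?P. a \<inter> R = {i}" if "i \<in> R" for i
    proof -
      obtain a where a: "a \<in> Q" "a \<inter> R = {i}" using Q(3)[OF \<open>i \<in> R\<close>] by blast
      have "q \<inter> R = p \<inter> R" using A by (auto simp: p_def)
      thus ?thesis using a by (cases "a = q") auto
    qed
    ultimately have "?P \<in> separating_partitions A R (Suc j)"
      unfolding separating_partitions_def by blast
    hence "(?P, p) \<in> (SIGMA P:separating_partitions A R (Suc j). P)" by simp
    moreover have "Q = (\<lambda>(P, p). insert (insert x p) (P - {p})) (?P, p)"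
      using p(3) pQ q(1) by auto
    ultimately show ?thesis by (intro UnI2 image_eqI)
  qed
next
  fix Q assume "Q \<in> ?S \<union> ?T"
  thus "Q \<in> ?L"
  proof
    assume "Q \<in> ?S"
    then obtain P where P: "P \<in> separating_partitions A R j" "Q = insert {x} P" by auto
    have part: "partition_on A P" using P by (simp add: separating_partitions_def)
    have "{x} \<notin> P" using partition_onD1[OF part] A(2) by auto
    moreover have "partition_on (insert x A) Q"
      using partition_on_insert[of "{x}" P "insert x A"] part A(2) partition_onD1[OF part]
      unfolding P(2) by (auto simp: disjnt_def)
    ultimately show ?thesis
      using P finite_elements[OF A(1) part] by (auto simp: separating_partitions_def)
  next
    assume "Q \<in> ?T"
    then obtain P p where P: "P \<in> separating_partitions A R (Suc j)" "p \<in> P"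
      "Q = insert (insert x p) (P - {p})" by auto
    have part: "partition_on A P" using P by (simp add: separating_partitions_def)
    have UP: "\<Union>P = A" and dP: "\<And>a b. a \<in> P \<Longrightarrow> b \<in> P \<Longrightarrow> a \<noteq> b \<Longrightarrow> a \<inter> b = {}" and eP: "{} \<notin> P"
      using part by (auto simp: partition_on_def disjoint_def)
    have fin: "finite P" using finite_elements[OF A(1) part] .
    have xP: "x \<notin> a" if "a \<in> P" for a using that UP A(2) by auto
    have "insert x p \<notin> P" using xP by auto
    hence "card Q = Suc j"
      using card_Suc_Diff1[OF fin P(2)] P(1,3) fin by (simp add: separating_partitions_def)
    moreover have "partition_on (insert x A) Q"
    proof (rule partition_onI)
      show "\<Union>Q = insert x A" using UP P by auto
      fix a b assume "a \<in> Q" "b \<in> Q" "a \<noteq> b"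
      thus "disjnt a b"
        using dP[of a b] dP[of a p] dP[of p b] xP P by (auto simp: disjnt_def)
    next
      show "{} \<notin> Q" using eP P(3) by auto
    qed
    moreover have "\<exists>a\<in>Q. a \<inter> R = {i}" if "i \<in> R" for i
    proof -
      obtain a where a: "a \<in> P" "a \<inter> R = {i}"
        using P(1) \<open>i \<in> R\<close> by (auto simp: separating_partitions_def)
      have "insert x p \<inter> R = p \<inter> R" using A by auto
      thus ?thesis using a P(3) by (cases "a = p") auto
    qed
    ultimately show ?thesis unfolding separating_partitions_def by blast
  qed
qed

text \<open>Both insertion maps are injective, and their images are disjoint because only the first
  makes \<open>{x}\<close> a block. In the second, each partition offers \<open>Suc j\<close> blocks
  to receive \<open>x\<close>.\<close>

lemma card_separating_partitions_insert:
  assumes A: "finite A" "x \<notin> A" "R \<subseteq> A"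
  shows "card (separating_partitions (insert x A) R (Suc j)) =
           Suc j * card (separating_partitions A R (Suc j)) + card (separating_partitions A R j)"
proof -
  let ?\<Sigma> = "SIGMA P:separating_partitions A R (Suc j). P"
  let ?f = "\<lambda>(P, p). insert (insert x p) (P - {p})"
  have blk: "x \<notin> p" "p \<noteq> {}" if "P \<in> separating_partitions A R k" "p \<in> P" for P p k
    using that A(2) by (auto simp: separating_partitions_def partition_on_def)
  have finP: "finite P" if "P \<in> separating_partitions A R k" for P k
    using that finite_elements[OF A(1)] by (auto simp: separating_partitions_def)
  have inj1: "inj_on (insert {x}) (separating_partitions A R j)"
  proof (rule inj_onI)
    fix P Q assume PQ: "P \<in> separating_partitions A R j" "Q \<in> separating_partitions A R j"
      "insert {x} P = insert {x} Q"
    have "{x} \<notin> P" "{x} \<notin> Q" using blk PQ by blast+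
    thus "P = Q" using PQ(3) by (simp add: insert_ident)
  qed
  have inj2: "inj_on ?f ?\<Sigma>"
  proof (rule inj_onI, clarify)
    fix P p Q q
    assume P: "P \<in> separating_partitions A R (Suc j)" "p \<in> P"
      and Q: "Q \<in> separating_partitions A R (Suc j)" "q \<in> Q"
      and eq: "insert (insert x p) (P - {p}) = insert (insert x q) (Q - {q})"
    have xP: "\<And>a. a \<in> P \<Longrightarrow> x \<notin> a" and xQ: "\<And>a. a \<in> Q \<Longrightarrow> x \<notin> a"
      using blk P Q by blast+
    \<comment> \<open>No block of \<open>Q\<close> contains \<open>x\<close>, so
      \<open>insert x q\<close> is the only block on the right containing it.\<close>
    have "insert x p = insert x q" using eq xQ by blast
    hence pq: "p = q" using xP[OF P(2)] xQ[OF Q(2)] by (simp add: insert_ident)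
    have "insert x p \<notin> P - {p}" "insert x p \<notin> Q - {q}"
      using xP[of "insert x p"] xQ[of "insert x p"] by auto
    hence "P - {p} = Q - {q}" using eq pq by (metis insert_ident)
    thus "P = Q \<and> p = q" using pq P Q by blast
  qed
  have disj: "insert {x} ` separating_partitions A R j \<inter> ?f ` ?\<Sigma> = {}"
  proof -
    have "insert {x} P \<noteq> insert (insert x p) (Q - {p})"
      if "Q \<in> separating_partitions A R (Suc j)" "p \<in> Q" for P Q p
    proof
      assume eq: "insert {x} P = insert (insert x p) (Q - {p})"
      have "{x} \<notin> Q" using blk that by blast
      hence "{x} = insert x p" using eq by blast
      thus False using blk[OF that] by auto
    qed
    thus ?thesis by fastforce
  qed
  have fin: "finite (separating_partitions A R k)" for k
    using A(1) by (rule finite_separating_partitions)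
  have "finite ?\<Sigma>" using fin finP by (intro finite_SigmaI) blast+
  hence "card (separating_partitions (insert x A) R (Suc j)) =
      card (separating_partitions A R j) + card ?\<Sigma>"
    unfolding separating_partitions_insert[OF A]
    using disj fin by (simp add: card_Un_disjoint card_image inj1 inj2)
  also have "card ?\<Sigma> = (\<Sum>P\<in>separating_partitions A R (Suc j). card P)"
    using fin finP by (intro card_SigmaI) blast+
  also have "\<dots> = (\<Sum>P\<in>separating_partitions A R (Suc j). Suc j)"
    by (intro sum.cong) (auto simp: separating_partitions_def)
  finally show ?thesis by simp
qed

text \<open>This is the start of the recurrence. All blocks lie in \<open>A\<close>, so a block
  meeting \<open>A\<close> in \<open>{i}\<close> is \<open>{i}\<close> itself; by disjointness these
  singletons are the only blocks.\<close>

lemma separating_partitions_self: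
  "separating_partitions A A j = (if card A = j then {(\<lambda>i. {i}) ` A} else {})"
proof -
  have uniq: "P = (\<lambda>i. {i}) ` A"
    if P: "partition_on A P" "\<forall>i\<in>A. \<exists>p\<in>P. p \<inter> A = {i}" for P
  proof -
    have sub: "p \<subseteq> A" "p \<noteq> {}" if "p \<in> P" for p using partition_onD1[OF P(1)] partition_onD3[OF P(1)] that by auto
    have sing: "{i} \<in> P" if "i \<in> A" for i
    proof -
      obtain p where "p \<in> P" "p \<inter> A = {i}" using P(2) \<open>i \<in> A\<close> by blast
      thus ?thesis using sub(1)[of p] by (simp add: inf_absorb1)
    qed
    have "p = {i}" if "p \<in> P" "i \<in> p" for p i
      using disjointD[OF partition_onD2[OF P(1)], of p "{i}"] that sing[of i] sub(1)[of p] by blast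
    hence "p \<in> (\<lambda>i. {i}) ` A" if "p \<in> P" for p using sub[of p] that by blast
    thus ?thesis using sing by blast
  qed
  have card: "card ((\<lambda>i. {i}) ` A) = card A" by (simp add: card_image)
  have "\<exists>p\<in>(\<lambda>i. {i}) ` A. p \<inter> A = {i}" if "i \<in> A" for i
    using that by (intro bexI[of _ "{i}"]) auto
  hence "(\<lambda>i. {i}) ` A \<in> separating_partitions A A (card A)"
    by (simp add: separating_partitions_def partition_on_singletons card del: bex_simps)
  moreover have "P = (\<lambda>i. {i}) ` A \<and> card A = j" if "P \<in> separating_partitions A A j" for P
    using that uniq[of P] card by (simp add: separating_partitions_def)
  ultimately show ?thesis by auto
qed

section \<open>Boundary values and recurrence of the \<open>r\<close>-Stirling numbers\<close>

lemma r_Stirling_self: "r_Stirling r r j = (if j = r then 1 else 0)"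
  by (simp add: r_Stirling_eq_card separating_partitions_self)

lemma r_Stirling_less:
  assumes "j < r"
  shows "r_Stirling r m j = 0"
proof -
  have "separating_partitions {1..m} {1..r} j = {}"
    using card_separating_le[of "{1..m}" _ "{1..r}" j] assms by fastforce
  thus ?thesis by (simp add: r_Stirling_eq_card)
qed

text \<open>The bound \<open>r \<le> m\<close> places the new element \<open>Suc m\<close> outside
  \<open>{1..r}\<close>.\<close>

lemma r_Stirling_Suc_Suc:
  assumes "r \<le> m"
  shows "r_Stirling r (Suc m) (Suc j) = Suc j * r_Stirling r m (Suc j) + r_Stirling r m j"
proof -
  have "{1..Suc m} = insert (Suc m) {1..m}" by auto
  thus ?thesis
    using card_separating_partitions_insert[of "{1..m}" "Suc m" "{1..r}" j] assms
    by (simp add: r_Stirling_eq_card)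
qed

lemma r_Stirling_0_0_Suc: "r_Stirling 0 (Suc m) 0 = 0"
proof -
  have False if P: "partition_on {1..Suc m} P" "card P = 0" for P
  proof -
    have "P = {}" using P finite_elements[of "{1..Suc m}" P] by simp
    thus False using partition_onD1[OF P(1)] by simp
  qed
  hence "separating_partitions {1..Suc m} {1..0} 0 = {}"
    by (auto simp: separating_partitions_def)
  thus ?thesis by (simp add: r_Stirling_eq_card)
qed

lemma r_Stirling_Suc_shift:
  "r_Stirling r (Suc n + r) (k + r) =
     (k + r) * r_Stirling r (n + r) (k + r) + (case k of 0 \<Rightarrow> 0 | Suc l \<Rightarrow> r_Stirling r (n + r) (l + r))"
proof (cases "k + r")
  \<comment> \<open>Here \<open>k = r = 0\<close>: a partition of a nonempty set has at least one
    block.\<close>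
  case 0
  thus ?thesis by (simp add: r_Stirling_0_0_Suc)
next
  case (Suc j)
  \<comment> \<open>For \<open>k = 0\<close> the recurrence yields a term with
    \<open>j = r - 1\<close> blocks, which is zero.\<close>
  thus ?thesis
    using r_Stirling_Suc_Suc[of r "n + r" j] r_Stirling_less[of j r "n + r"]
    by (cases k) auto
qed

section \<open>Exponential generating function\<close>

text \<open>Differentiation turns the series for \<open>k\<close> into \<open>k + r\<close> times
  itself plus \<open>k\<close> times its predecessor. After scaling by factorials this is the
  recurrence \<open>r_Stirling_Suc_shift\<close>; the predecessor is why \<open>k\<close> must be
  arbitrary in the induction.\<close>

lemma r_Stirling_egf:
  "fps_nth (fps_exp (of_nat r) * (fps_exp 1 - 1) ^ k) n =
     fact k * of_nat (r_Stirling r (n + r) (k + r)) / (fact n :: 'a :: field_char_0)"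
proof (induction n arbitrary: k)
  case 0
  show ?case by (simp add: r_Stirling_self fps_nth_power_0 power_0_left)
next
  case (Suc n)
  let ?F = "\<lambda>k. fps_exp (of_nat r) * (fps_exp 1 - 1) ^ k :: 'a fps"
  have deriv: "fps_deriv (?F k) =
      fps_const (of_nat (k + r)) * ?F k + (case k of 0 \<Rightarrow> 0 | Suc l \<Rightarrow> fps_const (of_nat k) * ?F l)"
  proof (cases k)
    case (Suc l)
    have "fps_deriv ((fps_exp 1 - 1) ^ k :: 'a fps) =
        fps_const (of_nat k) * (fps_exp 1 * (fps_exp 1 - 1) ^ l)"
      unfolding fps_deriv_power by (simp add: Suc mult.assoc del: power_Suc of_nat_Suc)
    \<comment> \<open>Writing \<open>fps_exp 1\<close> as \<open>(fps_exp 1 - 1) + 1\<close> splits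
      the derivative into multiples of \<open>?F k\<close> and \<open>?F l\<close>.\<close>
    hence "fps_deriv (?F k) = fps_const (of_nat r) * ?F k
        + fps_const (of_nat k) * fps_exp (of_nat r) * (fps_exp 1 - 1) ^ l * ((fps_exp 1 - 1) + 1)"
      by (simp add: algebra_simps del: power_Suc of_nat_Suc)
    also have "\<dots> = fps_const (of_nat (k + r)) * ?F k + fps_const (of_nat k) * ?F l"
      by (simp add: Suc algebra_simps flip: fps_const_add)
    finally show ?thesis by (simp add: Suc)
  qed simp
  have "of_nat (Suc n) * fps_nth (?F k) (Suc n) = fps_nth (fps_deriv (?F k)) n"
    by (simp only: fps_deriv_nth Suc_eq_plus1)
  also have "\<dots> = of_nat (k + r) * fps_nth (?F k) n
      + (case k of 0 \<Rightarrow> 0 | Suc l \<Rightarrow> of_nat k * fps_nth (?F l) n)"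
    unfolding deriv by (cases k) (simp_all add: mult.assoc del: of_nat_add of_nat_Suc)
  also have "\<dots> = fact k * of_nat (r_Stirling r (Suc n + r) (k + r)) / fact n"
    unfolding r_Stirling_Suc_shift Suc.IH
    by (cases k) (simp_all add: field_simps)
  finally show ?case
    by (simp add: field_simps del: of_nat_Suc)
qed

section \<open>The Bernoulli generating function as a formal power series\<close>

lemma fps_exp_minus_one_nz: "fps_exp 1 - 1 \<noteq> (0 :: 'a :: field_char_0 fps)"
proof
  assume "fps_exp 1 - 1 = (0 :: 'a fps)"
  hence "fps_nth (fps_exp 1 - 1) 1 = (0 :: 'a)" by simp
  thus False by simp
qed

text \<open>Multiplied by \<open>fps_X\<close>, the outer series becomes that of
  \<open>ln (1 + X)\<close>, the compositional inverse of \<open>fps_exp 1 - 1\<close>.\<close>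

lemma log_series_compose_exp:
  "(Abs_fps (\<lambda>k. (-1) ^ k / of_nat (Suc k)) oo (fps_exp 1 - 1)) * (fps_exp 1 - 1) =
     (fps_X :: 'a :: field_char_0 fps)"
proof -
  let ?A = "Abs_fps (\<lambda>k. (-1) ^ k / of_nat (Suc k)) :: 'a fps"
  let ?u = "fps_exp 1 - 1 :: 'a fps"
  have ln: "?A * fps_X = fps_ln 1"
    by (rule fps_ext) (simp add: fps_ln_def)
  have "(?A oo ?u) * ?u = (?A * fps_X) oo ?u"
    by (simp add: fps_compose_mult_distrib)
  also have "\<dots> = fps_inv ?u oo ?u"
    by (simp only: ln fps_ln_fps_exp_inv[OF one_neq_zero])
  also have "\<dots> = fps_X"
    by (rule fps_inv_fps_exp_compose) simp
  finally show ?thesis .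
qed

text \<open>Both sides converge and agree as functions near \<open>0\<close>, hence have equal
  coefficients. Clearing the denominator avoids the removable singularity.\<close>

lemma bernoulli_fps:
  "Abs_fps (\<lambda>n. complex_of_real (poly (bernoulli_poly n) x) / fact n) * (fps_exp 1 - 1) =
     fps_X * fps_exp (of_real x)"
proof (rule eval_fps_eqD)
  let ?P = "Abs_fps (\<lambda>n. complex_of_real (poly (bernoulli_poly n) x) / fact n)"
  let ?u = "fps_exp 1 - 1 :: complex fps"
  have sums: "(\<lambda>n. fps_nth ?P n * t ^ n) sums (t * exp (of_real x * t) / (exp t - 1))"
    if "t \<noteq> 0" "norm t < 2 * pi" for t
    using bernoulli_gf_bernoulli_poly that by (simp add: bernoulli_gf_def)
  \<comment> \<open>Convergence at \<open>t = 1\<close>, which is inside the disc of radius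
    \<open>2 * pi\<close>, already gives a positive radius.\<close>
  have "conv_radius (fps_nth ?P) \<ge> norm (1 :: complex)"
    using sums[of 1] pi_gt3 by (intro conv_radius_geI) (auto simp: sums_iff)
  hence radP: "fps_conv_radius ?P \<ge> 1"
    by (simp add: fps_conv_radius_def one_ereal_def)
  have radu: "fps_conv_radius ?u = \<infinity>"
    using fps_conv_radius_diff[of "fps_exp 1 :: complex fps" 1] by simp
  have "fps_conv_radius (?P * ?u) \<ge> 1"
    using fps_conv_radius_mult[of ?P ?u] radP radu by simp
  thus "fps_conv_radius (?P * ?u) > 0"
    by (rule less_le_trans[rotated]) simp
  show "fps_conv_radius (fps_X * fps_exp (of_real x) :: complex fps) > 0"
    using fps_conv_radius_mult[of "fps_X :: complex fps" "fps_exp (of_real x)"] by simp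
  have "eval_fps (?P * ?u) t = eval_fps (fps_X * fps_exp (of_real x)) t" if "norm t < 1" for t
  proof -
    have "ereal (norm t) < 1" using that by simp
    hence tP: "ereal (norm t) < fps_conv_radius ?P" using radP by (rule less_le_trans)
    have "eval_fps (?P * ?u) t = eval_fps ?P t * (exp t - 1)"
      using tP radu by (simp add: eval_fps_mult eval_fps_diff)
    also have "\<dots> = t * exp (of_real x * t)"
    \<comment> \<open>The defining identity excludes \<open>t = 0\<close>, but there both sides
      vanish.\<close>
    proof (cases "t = 0")
      case False
      have "norm t < 2 * pi" using that pi_gt3 by linarith
      thus ?thesis
        using False sums[OF False] exp_neq_1_in_ball[OF False]
        by (simp add: eval_fps_def sums_iff)
    qed simp
    finally show ?thesis by (simp add: eval_fps_mult)
  qed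
  thus "eventually (\<lambda>t. eval_fps (?P * ?u) t = eval_fps (fps_X * fps_exp (of_real x)) t) (nhds 0)"
    by (auto simp: eventually_nhds_metric intro!: exI[of _ 1])
qed

text \<open>Both sides have the same product with the nonzero series \<open>fps_exp 1 - 1\<close>,
  which can be cancelled.\<close>

lemma bernoulli_fps_eq_compose:
  "Abs_fps (\<lambda>n. complex_of_real (poly (bernoulli_poly n) x) / fact n) =
     fps_exp (of_real x) * (Abs_fps (\<lambda>k. (-1) ^ k / of_nat (Suc k)) oo (fps_exp 1 - 1))"
  (is "?P = _ * ?M")
proof -
  have "?P * (fps_exp 1 - 1) = fps_exp (of_real x) * ?M * (fps_exp 1 - 1)"
    unfolding bernoulli_fps mult.assoc log_series_compose_exp by (rule mult.commute)
  thus ?thesis by (rule mult_right_cancel[OF fps_exp_minus_one_nz, THEN iffD1])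
qed

section \<open>Comparison of coefficients\<close>

lemma fps_mult_compose_nth:
  fixes a b u :: "'a :: field fps"
  assumes "fps_nth u 0 = 0"
  shows "fps_nth (b * (a oo u)) n = (\<Sum>k=0..n. fps_nth a k * fps_nth (b * u ^ k) n)"
proof -
  \<comment> \<open>The power \<open>u ^ k\<close> has no terms below degree \<open>k\<close>, so
    the sum may be extended from \<open>m\<close> to \<open>n\<close>. A range independent of
    \<open>m\<close> permits the later exchange of sums.\<close>
  have "fps_nth (a oo u) m = (\<Sum>k=0..n. fps_nth a k * fps_nth (u ^ k) m)" if "m \<le> n" for m
    unfolding fps_compose_nth using that startsby_zero_power_prefix[OF assms]
    by (intro sum.mono_neutral_left) auto
  hence "fps_nth (b * (a oo u)) n =
      (\<Sum>i=0..n. \<Sum>k=0..n. fps_nth b i * (fps_nth a k * fps_nth (u ^ k) (n - i)))"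
    by (simp add: fps_mult_nth sum_distrib_left)
  also have "\<dots> = (\<Sum>k=0..n. fps_nth a k * fps_nth (b * u ^ k) n)"
    by (subst sum.swap) (simp add: fps_mult_nth sum_distrib_left mult.left_commute)
  finally show ?thesis .
qed

theorem theorem1p1:
  fixes n r :: nat
  shows "poly (bernoulli_poly n) (real r) =
           (\<Sum>k=0..n. (-1) ^ k * (fact k / (real k + 1)) * real (r_Stirling r (n + r) (k + r)))"
proof -
  let ?u = "fps_exp 1 - 1 :: complex fps"
  have "complex_of_real (poly (bernoulli_poly n) (real r)) / fact n =
      fps_nth (fps_exp (of_nat r) * (Abs_fps (\<lambda>k. (-1) ^ k / of_nat (Suc k)) oo ?u)) n"
    using arg_cong[OF bernoulli_fps_eq_compose[of "real r"], of "\<lambda>f. fps_nth f n"] by simp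
  \<comment> \<open>The logarithm contributes the sign and \<open>1 / (k + 1)\<close>, the
    generating function of the \<open>r\<close>-Stirling numbers the factor
    \<open>fact k\<close>.\<close>
  also have "\<dots> = (\<Sum>k=0..n. (-1) ^ k / of_nat (Suc k) *
      (fact k * of_nat (r_Stirling r (n + r) (k + r)) / fact n))"
    by (simp add: fps_mult_compose_nth r_Stirling_egf)
  also have "\<dots> = complex_of_real (\<Sum>k=0..n. (-1) ^ k * (fact k / (real k + 1)) *
      real (r_Stirling r (n + r) (k + r))) / fact n"
    by (simp add: sum_divide_distrib add.commute mult.assoc)
  finally have "complex_of_real (poly (bernoulli_poly n) (real r)) =
      complex_of_real (\<Sum>k=0..n. (-1) ^ k * (fact k / (real k + 1)) *
        real (r_Stirling r (n + r) (k + r)))"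
    by simp
  thus ?thesis by (simp only: of_real_eq_iff)
qed

end
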